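(* Let $\mathbf{x}_0,\mathbf{x}_1,\mathbf{x}\in\mathbb{R}^2$ be the vertices of a nondegenerate triangle (i.e. not collinear), let $u_0,u_1\in\mathbb{R}$, and let $\mathbf{b}\in\mathbb{R}^2$. Let $P$ be the (invertible) $2\times 2$ matrix $$P=\begin{bmatrix}(\mathbf{x}-\mathbf{x}_0)^T\\(\mathbf{x}-\mathbf{x}_1)^T\end{bmatrix}.$$ Consider the quadratic equation for $u\in\mathbb{R}$ $$\text{(FD)}\qquad [u-u_0,\;u-u_1]\,P^{-T}P^{-1}\begin{bmatrix}u-u_0\\ u-u_1\end{bmatrix}+2\mathbf{b}^TP^{-1}\begin{bmatrix}u-u_0\\ u-u_1\end{bmatrix}=0,$$ for each real $u$ the coefficients $c_0,c_1$ given by $$\begin{bmatrix}c_0\\c_1\end{bmatrix}=P^{-T}\left(\mathbf{b}+P^{-1}\begin{bmatrix}u-u_0\\ u-u_1\end{bmatrix}\right),$$ and the minimization problem $$\text{(MIN)}\qquad \min_{s\in[0,1]}\Big[s u_0+(1-s)u_1+\|\mathbf{b}\|\,\|\mathbf{x}-\mathbf{x}_s\|-\mathbf{b}\cdot(\mathbf{x}-\mathbf{x}_s)\Big],\qquad \mathbf{x}_s=s\mathbf{x}_0+(1-s)\mathbf{x}_1 .$$ 1. Let $u$ be a solution of (FD) such that the corresponding coefficients satisfy $c_0>0$ and $c_1>0$. Then $u$ is the solution of (MIN), i.e. $u$ equals the minimum value in (MIN), and the corresponding minimizer $s^*$ satisfies $0<s^*<1$. 2. Conversely, let $u$ be the solution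 (minimum value) of (MIN), with the corresponding minimizer $s^*$ satisfying $0<s^*<1$. Then $u$ is also a solution of (FD), and the corresponding coefficients satisfy $c_0>0$ and $c_1>0$.
   Context: $\|\cdot\|$ is the Euclidean norm on $\mathbb{R}^2$, $\cdot$ is the Euclidean inner product, and $P^{-T}=(P^{-1})^T$. The phrase "the corresponding minimizer $s^*$" means that the objective in (MIN) attains its minimum over $[0,1]$ at exactly one point, and $s^*$ is that point. Background: one seeks the value $u=U(\mathbf{x})$ of a function $U$ that is linear on the triangle $(\mathbf{x}_1,\mathbf{x}_0,\mathbf{x})$, with given values $u_0=U(\mathbf{x}_0)$ and $u_1=U(\mathbf{x}_1)$. The vector field $\mathbf{b}$ is approximated on the triangle by its constant value $\mathbf{b}=\mathbf{b}(\mathbf{x})$. Linearity gives $\nabla U=P^{-1}[u-u_0,\,u-u_1]^T$, and (FD) is the equation $\|\nabla U\|^2+2\mathbf{b}\cdot\nabla U=0$ with this gradient. The characteristic through $\mathbf{x}$ has direction $\mathbf{b}+\nabla U=c_0(\mathbf{x}-\mathbf{x}_0)+c_1(\mathbf{x}-\mathbf{x}_1)$. The phrase "the characteristic passing through $\mathbf{x}$ crosses the open interval $(\mathbf{x}_1,\mathbf{x}_0)$" means by definition that $c_0>0$ and $c_1>0$. *)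

theory Defs
  imports "HOL-Analysis.Analysis"
begin

(* For the row matrix P, "transpose (matrix_inv P)" is P^{-T}; matrix_inv is the
   genuine inverse when x0, x1, x are not collinear. *)

definition upd_matrix :: "real^2 \<Rightarrow> real^2 \<Rightarrow> real^2 \<Rightarrow> real^2^2" where
  "upd_matrix x0 x1 x = vector [x - x0, x - x1]"

definition upd_diff :: "real \<Rightarrow> real \<Rightarrow> real \<Rightarrow> real^2" where
  "upd_diff u0 u1 u = vector [u - u0, u - u1]"

definition fd_equation ::
  "real^2 \<Rightarrow> real^2 \<Rightarrow> real^2 \<Rightarrow> real \<Rightarrow> real \<Rightarrow> real^2 \<Rightarrow> real \<Rightarrow> bool" where
  "fd_equation x0 x1 x u0 u1 b u \<longleftrightarrow>
     (let Pinv = matrix_inv (upd_matrix x0 x1 x); d = upd_diff u0 u1 u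
      in d \<bullet> ((transpose Pinv ** Pinv) *v d) + 2 * (b \<bullet> (Pinv *v d)) = 0)"

(* The components with index 1 and 2 are c0 and c1, respectively. *)
definition char_coeffs ::
  "real^2 \<Rightarrow> real^2 \<Rightarrow> real^2 \<Rightarrow> real \<Rightarrow> real \<Rightarrow> real^2 \<Rightarrow> real \<Rightarrow> real^2" where
  "char_coeffs x0 x1 x u0 u1 b u =
     (let Pinv = matrix_inv (upd_matrix x0 x1 x)
      in transpose Pinv *v (b + Pinv *v upd_diff u0 u1 u))"

definition edge_point :: "real^2 \<Rightarrow> real^2 \<Rightarrow> real \<Rightarrow> real^2" where
  "edge_point x0 x1 s = s *\<^sub>R x0 + (1 - s) *\<^sub>R x1"

definition min_objective ::
  "real^2 \<Rightarrow> real^2 \<Rightarrow> real^2 \<Rightarrow> real \<Rightarrow> real \<Rightarrow> real^2 \<Rightarrow> real \<Rightarrow> real" where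
  "min_objective x0 x1 x u0 u1 b s =
     s * u0 + (1 - s) * u1 + norm b * norm (x - edge_point x0 x1 s)
       - b \<bullet> (x - edge_point x0 x1 s)"

(* u is the minimum value over [0,1], attained there at s and at no other point. *)
definition min_solution ::
  "real^2 \<Rightarrow> real^2 \<Rightarrow> real^2 \<Rightarrow> real \<Rightarrow> real \<Rightarrow> real^2 \<Rightarrow> real \<Rightarrow> real \<Rightarrow> bool" where
  "min_solution x0 x1 x u0 u1 b u s \<longleftrightarrow>
     {t. is_arg_min (min_objective x0 x1 x u0 u1 b) (\<lambda>r. r \<in> {0..1}) t} = {s} \<and>
     u = min_objective x0 x1 x u0 u1 b s"

end

theory Submission
  imports Defs
begin

text \<open>
  Fix \<open>u\<close>, let \<open>q = P\<^sup>-\<^sup>1 [u - u0, u - u1]\<^sup>T\<close> be the gradient of the linear interpolant, and let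
  \<open>p = b + q\<close> be the characteristic direction. Two observations turn both problems into statements
  about \<open>p\<close> alone.

  Completing the square, the quadratic equation for \<open>u\<close> says \<open>\<parallel>p\<parallel> = \<parallel>b\<parallel>\<close>
  (\<open>fd_equation_iff_norm_eq\<close>). Moreover the linear interpolant takes the value
  \<open>s u0 + (1 - s) u1\<close> at \<open>x\<^sub>s\<close>, so the objective is
  \<open>u + (\<parallel>b\<parallel> \<parallel>x - x\<^sub>s\<parallel> - p \<bullet> (x - x\<^sub>s))\<close> (\<open>min_objective_eq_defect\<close>): up to the constant \<open>u\<close> it is
  the expression in parentheses, called the defect below because for \<open>\<parallel>p\<parallel> = \<parallel>b\<parallel>\<close> it is the defect in
  the Cauchy-Schwarz inequality.

  If \<open>\<parallel>p\<parallel> = \<parallel>b\<parallel>\<close> and \<open>p = c0 (x - x0) + c1 (x - x1)\<close> with positive coefficients, the defect is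
  nonnegative and vanishes exactly where \<open>x - x\<^sub>s\<close> points along \<open>p\<close>, which happens only at
  \<open>s = c0 / (c0 + c1)\<close>. Conversely, let \<open>u\<close> be the minimum value, attained at an interior point.
  There the defect and its derivative both vanish, which fixes the inner products of \<open>p\<close> with two
  independent vectors and forces \<open>p\<close> to be \<open>x - x\<^sub>s\<close> rescaled to length \<open>\<parallel>b\<parallel>\<close>. The coefficients of \<open>p\<close>
  are then \<open>s\<close> and \<open>1 - s\<close> times \<open>\<parallel>b\<parallel> / \<parallel>x - x\<^sub>s\<parallel>\<close>. Uniqueness of the minimizer enters only to
  exclude \<open>b = 0\<close>, where the objective would be constant.
\<close>

section \<open>Linear algebra of the triangle\<close>

definition interpolant_gradient ::
  "real^2 \<Rightarrow> real^2 \<Rightarrow> real^2 \<Rightarrow> real \<Rightarrow> real \<Rightarrow> real \<Rightarrow> real^2" where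
  "interpolant_gradient x0 x1 x u0 u1 u =
     matrix_inv (upd_matrix x0 x1 x) *v upd_diff u0 u1 u"

lemma edge_vectors_independent:
  fixes x0 x1 x :: "'a::real_normed_vector"
  assumes "\<not> collinear {x0, x1, x}"
    and eq: "\<alpha> *\<^sub>R (x - x0) + \<beta> *\<^sub>R (x - x1) = 0"
  shows "\<alpha> = 0 \<and> \<beta> = 0"
proof -
  have col: "collinear {0, x0 - x, x1 - x}" if "\<alpha> \<noteq> 0 \<or> \<beta> \<noteq> 0"
  proof (cases "\<beta> = 0")
    case True
    then show ?thesis using that eq by simp
  next
    case False
    have "\<beta> *\<^sub>R (x1 - x) = \<beta> *\<^sub>R ((- \<alpha> / \<beta>) *\<^sub>R (x0 - x))"
      using eq False by (simp add: algebra_simps)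
    then have "x1 - x = (- \<alpha> / \<beta>) *\<^sub>R (x0 - x)"
      using False by (metis scaleR_cancel_left)
    then show ?thesis by (metis collinear_lemma)
  qed
  have "collinear {x0, x, x1} \<longleftrightarrow> collinear {0, x0 - x, x1 - x}"
    by (rule collinear_3) (simp add: NO_MATCH_def)
  with col assms(1) show ?thesis
    by (metis insert_commute)
qed

lemma matrix_inv_left_right:
  fixes A :: "'a::semiring_1^'n^'m"
  assumes "invertible A"
  shows matrix_inv_right: "A ** matrix_inv A = mat 1"
    and matrix_inv_left: "matrix_inv A ** A = mat 1"
  using someI_ex[OF assms[unfolded invertible_def]] by (simp_all add: matrix_inv_def)

lemma transpose_upd_matrix_mult:
  "transpose (upd_matrix x0 x1 x) *v c = c $ 1 *\<^sub>R (x - x0) + c $ 2 *\<^sub>R (x - x1)"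
  by (simp add: vec_eq_iff matrix_vector_mult_def transpose_def upd_matrix_def sum_2 mult.commute)

lemma upd_matrix_mult:
  "(upd_matrix x0 x1 x *v w) $ 1 = (x - x0) \<bullet> w" "(upd_matrix x0 x1 x *v w) $ 2 = (x - x1) \<bullet> w"
  by (simp_all add: matrix_vector_mult_def upd_matrix_def inner_vec_def)

lemma invertible_upd_matrix:
  assumes "\<not> collinear {x0, x1, x}"
  shows "invertible (upd_matrix x0 x1 x)"
proof -
  have "c = 0" if "transpose (upd_matrix x0 x1 x) *v c = 0" for c
  proof -
    have "c $ 1 = 0 \<and> c $ 2 = 0"
      using edge_vectors_independent[OF assms] that unfolding transpose_upd_matrix_mult .
    then show ?thesis by (simp add: vec_eq_iff forall_2)
  qed
  then have "invertible (transpose (upd_matrix x0 x1 x))"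
    by (simp add: invertible_left_inverse matrix_left_invertible_ker)
  then show ?thesis
    using transpose_invertible by fastforce
qed

lemma inner_interpolant_gradient:
  assumes "\<not> collinear {x0, x1, x}"
  shows "(x - x0) \<bullet> interpolant_gradient x0 x1 x u0 u1 u = u - u0"
    and "(x - x1) \<bullet> interpolant_gradient x0 x1 x u0 u1 u = u - u1"
proof -
  have "upd_matrix x0 x1 x *v interpolant_gradient x0 x1 x u0 u1 u = upd_diff u0 u1 u"
    unfolding interpolant_gradient_def
    by (simp add: matrix_vector_mul_assoc matrix_inv_right invertible_upd_matrix assms)
  then show "(x - x0) \<bullet> interpolant_gradient x0 x1 x u0 u1 u = u - u0"
    and "(x - x1) \<bullet> interpolant_gradient x0 x1 x u0 u1 u = u - u1"
    using upd_matrix_mult[of x0 x1 x "interpolant_gradient x0 x1 x u0 u1 u"]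
    by (simp_all add: upd_diff_def)
qed

section \<open>Both problems in terms of the characteristic direction\<close>

text \<open>Completing the square in \<open>\<parallel>q\<parallel>\<^sup>2 + 2 b \<bullet> q = 0\<close> gives \<open>\<parallel>b + q\<parallel>\<^sup>2 = \<parallel>b\<parallel>\<^sup>2\<close>.\<close>

lemma fd_equation_iff_norm_eq:
  "fd_equation x0 x1 x u0 u1 b u \<longleftrightarrow>
     norm (b + interpolant_gradient x0 x1 x u0 u1 u) = norm b"
proof -
  define q where "q = interpolant_gradient x0 x1 x u0 u1 u"
  define M where "M = matrix_inv (upd_matrix x0 x1 x)"
  define d where "d = upd_diff u0 u1 u"
  have q: "q = M *v d"
    by (simp add: q_def M_def d_def interpolant_gradient_def)
  have "d \<bullet> ((transpose M ** M) *v d) = q \<bullet> q"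
    unfolding q by (metis dot_lmul_matrix matrix_vector_mul_assoc transpose_matrix_vector inner_commute)
  then have "fd_equation x0 x1 x u0 u1 b u \<longleftrightarrow> q \<bullet> q + 2 * (b \<bullet> q) = 0"
    by (simp add: fd_equation_def Let_def q flip: M_def d_def)
  also have "\<dots> \<longleftrightarrow> (b + q) \<bullet> (b + q) = b \<bullet> b"
    by (auto simp: inner_add_left inner_add_right inner_commute)
  also have "\<dots> \<longleftrightarrow> norm (b + q) = norm b"
    by (simp add: norm_eq)
  finally show ?thesis by (simp add: q_def)
qed

text \<open>Applying \<open>P\<^sup>T\<close> to the defining formula recovers the coefficients as those of the
  characteristic direction in the basis \<open>x - x0\<close>, \<open>x - x1\<close>.\<close>

lemma char_coeffs_eq_iff:
  assumes "\<not> collinear {x0, x1, x}"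
  shows "char_coeffs x0 x1 x u0 u1 b u = c \<longleftrightarrow>
    b + interpolant_gradient x0 x1 x u0 u1 u = c $ 1 *\<^sub>R (x - x0) + c $ 2 *\<^sub>R (x - x1)"
proof -
  define P where "P = upd_matrix x0 x1 x"
  have "invertible P"
    using invertible_upd_matrix[OF assms] by (simp add: P_def)
  then have "transpose P ** transpose (matrix_inv P) = mat 1"
    and "transpose (matrix_inv P) ** transpose P = mat 1"
    by (simp_all add: matrix_inv_left matrix_inv_right transpose_mat flip: matrix_transpose_mul)
  then have "transpose (matrix_inv P) *v p = c \<longleftrightarrow> p = transpose P *v c" for p
    by (metis matrix_vector_mul_assoc matrix_vector_mul_lid)
  then show ?thesis
    unfolding char_coeffs_def Let_def interpolant_gradient_def P_def transpose_upd_matrix_mult .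
qed

lemma diff_edge_point: "x - edge_point x0 x1 s = s *\<^sub>R (x - x0) + (1 - s) *\<^sub>R (x - x1)"
  by (simp add: edge_point_def algebra_simps)

lemma edge_point_neq_apex:
  assumes "\<not> collinear {x0, x1, x}"
  shows "x - edge_point x0 x1 s \<noteq> 0"
proof
  assume "x - edge_point x0 x1 s = 0"
  then have "s *\<^sub>R (x - x0) + (1 - s) *\<^sub>R (x - x1) = 0"
    by (simp add: diff_edge_point)
  from edge_vectors_independent[OF assms this] show False by auto
qed

text \<open>The interpolant drops by \<open>q \<bullet> (x - x\<^sub>s)\<close> between \<open>x\<close> and \<open>x\<^sub>s\<close>; this merges the boundary
  data and the \<open>b\<close>-term of the objective into one inner product with \<open>b + q\<close>.\<close>

lemma min_objective_eq_defect:
  assumes "\<not> collinear {x0, x1, x}"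
  shows "min_objective x0 x1 x u0 u1 b s =
    u + (norm b * norm (x - edge_point x0 x1 s)
         - (b + interpolant_gradient x0 x1 x u0 u1 u) \<bullet> (x - edge_point x0 x1 s))"
proof -
  have "interpolant_gradient x0 x1 x u0 u1 u \<bullet> (x - edge_point x0 x1 s)
      = s * (u - u0) + (1 - s) * (u - u1)"
    using inner_interpolant_gradient[OF assms, of u0 u1 u]
    by (simp add: diff_edge_point inner_add_right inner_commute)
  then show ?thesis
    by (simp add: min_objective_def inner_add_left algebra_simps)
qed

lemma min_solution_iff:
  "min_solution x0 x1 x u0 u1 b u s \<longleftrightarrow>
     s \<in> {0..1} \<and> min_objective x0 x1 x u0 u1 b s = u \<and>
     (\<forall>t\<in>{0..1}. t \<noteq> s \<longrightarrow> u < min_objective x0 x1 x u0 u1 b t)"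
  (is "?L \<longleftrightarrow> ?R")
proof
  assume ?L
  then have *: "{t. is_arg_min (min_objective x0 x1 x u0 u1 b) (\<lambda>r. r \<in> {0..1}) t} = {s}"
    and u: "u = min_objective x0 x1 x u0 u1 b s"
    by (auto simp: min_solution_def)
  then have s: "is_arg_min (min_objective x0 x1 x u0 u1 b) (\<lambda>r. r \<in> {0..1}) s"
    by blast
  have "u < min_objective x0 x1 x u0 u1 b t" if "t \<in> {0..1}" "t \<noteq> s" for t
  proof (rule ccontr)
    assume "\<not> u < min_objective x0 x1 x u0 u1 b t"
    then have "is_arg_min (min_objective x0 x1 x u0 u1 b) (\<lambda>r. r \<in> {0..1}) t"
      using s that unfolding u is_arg_min_linorder by force
    with * that show False by blast
  qed
  with s u show ?R
    by (simp add: is_arg_min_def)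
next
  assume ?R
  then show ?L
    unfolding min_solution_def is_arg_min_linorder
    by (auto simp: less_le) (metis order.antisym atLeastAtMost_iff)+
qed

section \<open>From the quadratic equation to the minimum\<close>

text \<open>With \<open>\<parallel>p\<parallel> = \<parallel>b\<parallel>\<close> the defect is that of the Cauchy-Schwarz inequality for \<open>p\<close> and \<open>x - x\<^sub>t\<close>, and
  equality holds only where the ray from \<open>x\<close> in direction \<open>-p\<close> meets the edge.\<close>

lemma fd_solution_is_min_solution:
  assumes nc: "\<not> collinear {x0, x1, x}"
    and fd: "fd_equation x0 x1 x u0 u1 b u"
    and c0: "char_coeffs x0 x1 x u0 u1 b u $ 1 > 0"
    and c1: "char_coeffs x0 x1 x u0 u1 b u $ 2 > 0"
  shows "\<exists>s. min_solution x0 x1 x u0 u1 b u s \<and> 0 < s \<and> s < 1"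
proof -
  define c0 c1 where "c0 = char_coeffs x0 x1 x u0 u1 b u $ 1"
    and "c1 = char_coeffs x0 x1 x u0 u1 b u $ 2"
  define p where "p = b + interpolant_gradient x0 x1 x u0 u1 u"
  define d where "d t = x - edge_point x0 x1 t" for t
  \<comment> \<open>The parameter at which \<open>d s\<close> is proportional to \<open>p\<close>.\<close>
  define s where "s = c0 / (c0 + c1)"
  have pos: "c0 > 0" "c1 > 0"
    using c0 c1 by (simp_all add: c0_def c1_def)
  have p_coeffs: "p = c0 *\<^sub>R (x - x0) + c1 *\<^sub>R (x - x1)"
    using char_coeffs_eq_iff[OF nc] unfolding p_def c0_def c1_def by blast
  have d_coeffs: "d t = t *\<^sub>R (x - x0) + (1 - t) *\<^sub>R (x - x1)" for t
    by (simp add: d_def diff_edge_point)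
  have norm_p: "norm p = norm b"
    using fd by (simp add: fd_equation_iff_norm_eq p_def)
  have objective: "min_objective x0 x1 x u0 u1 b t = u + (norm p * norm (d t) - p \<bullet> d t)" for t
    by (simp add: norm_p min_objective_eq_defect[OF nc, of u0 u1 b t u] flip: p_def d_def)
  have "p \<noteq> 0"
    using edge_vectors_independent[OF nc, of c0 c1] pos p_coeffs by auto
  have s: "0 < s" "s < 1"
    using pos by (simp_all add: s_def)
  have "1 - s = c1 / (c0 + c1)"
    using pos by (simp add: s_def field_simps)
  then have p_d: "p = (c0 + c1) *\<^sub>R d s"
    using pos by (simp add: p_coeffs d_coeffs s_def scaleR_add_right)
  have at_s: "p \<bullet> d s = norm p * norm (d s)"
    unfolding p_d using pos by (simp flip: power2_norm_eq_inner add: power2_eq_square)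
  have only_s: "p \<bullet> d t < norm p * norm (d t)" if "t \<noteq> s" for t
  proof (rule ccontr)
    assume "\<not> p \<bullet> d t < norm p * norm (d t)"
    then have "p \<bullet> d t = norm p * norm (d t)"
      using norm_cauchy_schwarz[of p "d t"] by linarith
    then have "norm p *\<^sub>R d t = norm (d t) *\<^sub>R p"
      by (simp add: norm_cauchy_schwarz_eq)
    then have "norm p *\<^sub>R (t *\<^sub>R (x - x0) + (1 - t) *\<^sub>R (x - x1))
        = norm (d t) *\<^sub>R (c0 *\<^sub>R (x - x0) + c1 *\<^sub>R (x - x1))"
      by (simp flip: p_coeffs d_coeffs)
    then have "(norm p * t - norm (d t) * c0) *\<^sub>R (x - x0)
        + (norm p * (1 - t) - norm (d t) * c1) *\<^sub>R (x - x1) = 0"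
      by (simp add: scaleR_left_diff_distrib scaleR_add_right algebra_simps)
    then have eqs: "norm p * t = norm (d t) * c0" "norm p * (1 - t) = norm (d t) * c1"
      using edge_vectors_independent[OF nc] by fastforce+
    then have "norm p = norm (d t) * (c0 + c1)"
      by (simp add: algebra_simps)
    with eqs(1) have "norm p * (t * (c0 + c1)) = norm p * c0"
      by (metis mult.assoc mult.commute)
    then have "t * (c0 + c1) = c0"
      using \<open>p \<noteq> 0\<close> by (metis mult_left_cancel norm_eq_zero)
    then have "t = s"
      using pos by (simp add: s_def field_simps)
    with that show False by simp
  qed
  have "min_solution x0 x1 x u0 u1 b u s"
    using s at_s only_s by (simp add: min_solution_iff objective)
  with s show ?thesis by blast
qed

section \<open>From the minimum to the quadratic equation\<close>

text \<open>The first-order condition for the defect along a line. The gradient of \<open>\<parallel>\<cdot>\<parallel>\<close> at \<open>v s\<close> is the unit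
  vector \<open>sgn (v s)\<close>, and a critical point only constrains its component along the line.\<close>

lemma inner_direction_at_local_min:
  fixes p a e :: "'a::real_inner"
  defines "v \<equiv> \<lambda>t::real. a + t *\<^sub>R e"
  assumes nz: "v s \<noteq> 0" and "\<delta> > 0"
    and min: "\<And>t. \<bar>s - t\<bar> < \<delta> \<Longrightarrow> B * norm (v s) - p \<bullet> v s \<le> B * norm (v t) - p \<bullet> v t"
  shows "p \<bullet> e = (B *\<^sub>R sgn (v s)) \<bullet> e"
proof -
  have "(v has_derivative (\<lambda>h. h *\<^sub>R e)) (at s)"
    unfolding v_def by (auto intro!: derivative_eq_intros)
  then have "((\<lambda>t. B * norm (v t) - p \<bullet> v t) has_derivative
      (\<lambda>h. B * ((h *\<^sub>R e) \<bullet> sgn (v s)) - p \<bullet> (h *\<^sub>R e))) (at s)"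
    using nz
    by (auto intro!: derivative_eq_intros has_derivative_compose[of v _ s UNIV norm] has_derivative_norm)
  then have "((\<lambda>t. B * norm (v t) - p \<bullet> v t) has_field_derivative
      (B * (e \<bullet> sgn (v s)) - p \<bullet> e)) (at s)"
    unfolding has_field_derivative_def
    by (rule back_subst[where P = "\<lambda>D. (_ has_derivative D) _"])
       (simp add: fun_eq_iff algebra_simps)
  then have "B * (e \<bullet> sgn (v s)) - p \<bullet> e = 0"
    using \<open>\<delta> > 0\<close> min by (intro DERIV_local_min) auto
  then show ?thesis by (simp add: inner_commute)
qed

text \<open>Here \<open>\<parallel>p\<parallel> = \<parallel>b\<parallel>\<close> has to be derived. A vanishing defect at the minimizer \<open>s\<close> gives the component
  of \<open>p\<close> along \<open>x - x\<^sub>s\<close>, and a vanishing derivative its component along the edge; together they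
  determine \<open>p\<close>.\<close>

lemma min_solution_is_fd_solution:
  assumes nc: "\<not> collinear {x0, x1, x}"
    and min: "min_solution x0 x1 x u0 u1 b u s" and s: "0 < s" "s < 1"
  shows "fd_equation x0 x1 x u0 u1 b u \<and>
         char_coeffs x0 x1 x u0 u1 b u $ 1 > 0 \<and> char_coeffs x0 x1 x u0 u1 b u $ 2 > 0"
proof -
  define p where "p = b + interpolant_gradient x0 x1 x u0 u1 u"
  define d where "d t = x - edge_point x0 x1 t" for t
  have objective: "min_objective x0 x1 x u0 u1 b t = u + (norm b * norm (d t) - p \<bullet> d t)" for t
    unfolding p_def d_def by (rule min_objective_eq_defect[OF nc])
  have d_coeffs: "d t = t *\<^sub>R (x - x0) + (1 - t) *\<^sub>R (x - x1)" for t
    by (simp add: d_def diff_edge_point)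
  have d_line: "d t = (x - x1) + t *\<^sub>R (x1 - x0)" for t
    by (simp add: d_coeffs algebra_simps)
  have nz: "d s \<noteq> 0"
    unfolding d_def by (rule edge_point_neq_apex[OF nc])
  have strict: "0 < norm b * norm (d t) - p \<bullet> d t" if "t \<in> {0..1}" "t \<noteq> s" for t
    using min that by (auto simp: min_solution_iff objective)
  have at_s: "norm b * norm (d s) - p \<bullet> d s = 0"
    using min by (auto simp: min_solution_iff objective)
  define w where "w = norm b *\<^sub>R sgn (d s)"
  have along_edge: "p \<bullet> (x1 - x0) = w \<bullet> (x1 - x0)"
    unfolding w_def d_line
  proof (rule inner_direction_at_local_min)
    \<comment> \<open>The minimum over \<open>[0,1]\<close> is local in the ball of radius \<open>min s (1 - s)\<close>.\<close>
    show "min s (1 - s) > 0" using s by simp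
    fix t :: real
    assume "\<bar>s - t\<bar> < min s (1 - s)"
    then have "t \<in> {0..1}" by auto
    then have "norm b * norm (d s) - p \<bullet> d s \<le> norm b * norm (d t) - p \<bullet> d t"
      using at_s strict[of t] by (cases "t = s") auto
    then show "norm b * norm (x - x1 + s *\<^sub>R (x1 - x0)) - p \<bullet> (x - x1 + s *\<^sub>R (x1 - x0))
        \<le> norm b * norm (x - x1 + t *\<^sub>R (x1 - x0)) - p \<bullet> (x - x1 + t *\<^sub>R (x1 - x0))"
      unfolding d_line .
  qed (use nz d_line in simp)
  have along_d: "p \<bullet> d s = w \<bullet> d s"
    using at_s nz by (simp add: w_def sgn_div_norm field_simps power2_eq_square flip: power2_norm_eq_inner)
  \<comment> \<open>\<open>d s\<close> and the edge direction span the plane.\<close>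
  have "p = w"
  proof -
    have eqs: "x - x0 = d s + (1 - s) *\<^sub>R (x1 - x0)" "x - x1 = d s - s *\<^sub>R (x1 - x0)"
      by (simp_all add: d_line algebra_simps)
    have "d s \<bullet> (p - w) = 0" "(x1 - x0) \<bullet> (p - w) = 0"
      using along_edge along_d by (simp_all only: inner_diff_right[of _ p w] inner_commute[of _ p]
        inner_commute[of _ w] diff_self)
    then have "(x - x0) \<bullet> (p - w) = 0" "(x - x1) \<bullet> (p - w) = 0"
      unfolding eqs inner_add_left inner_diff_left[of "d s"] inner_scaleR_left by simp_all
    then have "upd_matrix x0 x1 x *v (p - w) = 0"
      by (simp add: vec_eq_iff forall_2 upd_matrix_mult)
    moreover have "\<exists>M. M ** upd_matrix x0 x1 x = mat 1"
      using invertible_upd_matrix[OF nc] by (auto simp: invertible_left_inverse)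
    ultimately have "p - w = 0"
      using matrix_left_invertible_ker by blast
    then show ?thesis by simp
  qed
  \<comment> \<open>Otherwise \<open>p = 0\<close> and the objective is constant, so \<open>0\<close> is a second minimizer.\<close>
  have "b \<noteq> 0"
  proof
    assume "b = 0"
    then have "norm b * norm (d 0) - p \<bullet> d 0 = 0"
      by (simp add: \<open>p = w\<close> w_def)
    with strict[of 0] s show False by simp
  qed
  define k where "k = norm b / norm (d s)"
  have "k > 0" using \<open>b \<noteq> 0\<close> nz by (simp add: k_def)
  have "p = k *\<^sub>R d s"
    by (simp add: \<open>p = w\<close> w_def k_def sgn_div_norm divide_inverse)
  also have "\<dots> = (k * s) *\<^sub>R (x - x0) + (k * (1 - s)) *\<^sub>R (x - x1)"
    by (simp add: d_coeffs scaleR_add_right)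
  finally have "char_coeffs x0 x1 x u0 u1 b u = vector [k * s, k * (1 - s)]"
    by (simp add: char_coeffs_eq_iff[OF nc] p_def)
  moreover have "norm p = norm b"
    using nz by (simp add: \<open>p = w\<close> w_def norm_sgn)
  ultimately show ?thesis
    using \<open>k > 0\<close> s by (simp add: fd_equation_iff_norm_eq p_def)
qed

section \<open>Equivalence of the two discretizations\<close>

theorem theorem1:
  fixes x0 x1 x b :: "real^2" and u0 u1 :: real
  assumes "\<not> collinear {x0, x1, x}"
  shows "(\<forall>u. fd_equation x0 x1 x u0 u1 b u \<and>
              char_coeffs x0 x1 x u0 u1 b u $ 1 > 0 \<and>
              char_coeffs x0 x1 x u0 u1 b u $ 2 > 0
            \<longrightarrow> (\<exists>s. min_solution x0 x1 x u0 u1 b u s \<and> 0 < s \<and> s < 1))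
       \<and> (\<forall>u s. min_solution x0 x1 x u0 u1 b u s \<and> 0 < s \<and> s < 1
            \<longrightarrow> fd_equation x0 x1 x u0 u1 b u \<and>
                char_coeffs x0 x1 x u0 u1 b u $ 1 > 0 \<and>
                char_coeffs x0 x1 x u0 u1 b u $ 2 > 0)"
  using fd_solution_is_min_solution[OF assms] min_solution_is_fd_solution[OF assms] by blast

end
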